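(* Let $\mathcal{X}$ be a finite dimensional real inner product space, $g:\mathcal{X}\to\mathbb{R}^{m\times n}$ continuously differentiable, $1\le k\le m\le n$, $\theta=\|\cdot\|_{(k)}$ the Ky Fan $k$-norm, $\mathcal{K}=\mathrm{epi}\,\theta$, and $G(x,t)=(g(x),t)$ for $(x,t)\in\mathcal{X}\times\mathbb{R}$. Let $\bar x\in\mathcal{X}$ and $\overline X=g(\bar x)$. Then the constraint nondegeneracy condition $$G'(\bar x,\bar t)(\mathcal{X}\times\mathbb{R})+\mathrm{lin}\big(\mathcal{T}_{\mathcal{K}}(\overline X,\bar t)\big)=\mathbb{R}^{m\times n}\times\mathbb{R}$$ holds at $(\bar x,\bar t)=(\bar x,\theta(\overline X))$ if and only if $$g'(\bar x)\mathcal{X}+\mathcal{T}^{\mathrm{lin}}(\overline X)=\mathbb{R}^{m\times n}.$$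
   Context: $\|Z\|_{(k)}$ is the sum of the $k$ largest singular values of $Z\in\mathbb{R}^{m\times n}$. $\mathrm{epi}\,\theta=\{(X,t)\in\mathbb{R}^{m\times n}\times\mathbb{R}\mid t\ge\|X\|_{(k)}\}$. The tangent cone is $\mathcal{T}_{\mathcal{K}}(\overline X,\bar t)=\{(H,\tau)\mid\exists\rho_j\downarrow0,\ \mathrm{dist}((\overline X,\bar t)+\rho_j(H,\tau),\mathcal{K})=o(\rho_j)\}$, and $\mathrm{lin}(C)=C\cap(-C)$ is the lineality space (largest linear subspace) of a closed convex cone $C$. $\mathcal{T}^{\mathrm{lin}}(\overline X)=\{H\in\mathbb{R}^{m\times n}\mid\theta'(\overline X;H)=-\theta'(\overline X;-H)\}$, where $\theta'(\overline X;\cdot)$ is the directional derivative. *)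

theory Defs
  imports
    "HOL-Analysis.Analysis"
    "HOL-Computational_Algebra.Computational_Algebra"
    "HOL-Library.Landau_Symbols"
    "HOL-Library.Set_Algebras"
begin

definition char_poly :: "'a::comm_ring_1 ^ 'n ^ 'n \<Rightarrow> 'a poly" where
  "char_poly A = det (mat [:0, 1:] - map_matrix (\<lambda>a. [:a:]) A)"

text \<open>
  An \<open>m \<times> n\<close> matrix has type \<^typ>\<open>real ^ 'n ^ 'm\<close>. Its singular values are the square roots of
  the eigenvalues of \<open>Z Z\<^sup>T\<close>, counted with multiplicity and listed in nonincreasing order. As
  \<open>Z Z\<^sup>T\<close> is symmetric positive semidefinite of order \<open>m\<close>, its characteristic polynomial has \<open>m\<close>
  real nonnegative roots, so the list has length \<open>m\<close>. For \<open>m \<le> n\<close> these are all the singular values.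
\<close>
definition singular_values :: "real ^ 'n ^ 'm \<Rightarrow> real list" where
  "singular_values Z =
     rev (sorted_list_of_multiset (image_mset sqrt (proots (char_poly (Z ** transpose Z)))))"

definition ky_fan_norm :: "nat \<Rightarrow> real ^ 'n ^ 'm \<Rightarrow> real" where
  "ky_fan_norm k Z = sum_list (take k (singular_values Z))"

text \<open>
  Here \<open>\<rho>\<^sub>j \<down> 0\<close> means \<open>\<rho>\<^sub>j > 0\<close> and \<open>\<rho>\<^sub>j \<rightarrow> 0\<close>. On matrices and on products, \<^const>\<open>infdist\<close> is the
  distance of the Frobenius norm and of the Euclidean product norm. Pitfall: \<^const>\<open>infdist\<close> to the
  empty set is \<open>0\<close>, so the definition is meaningful only for nonempty \<open>K\<close>.
\<close>
definition tangent_cone :: "'a::real_normed_vector set \<Rightarrow> 'a \<Rightarrow> 'a set" where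
  "tangent_cone K x =
     {h. \<exists>\<rho> :: nat \<Rightarrow> real. (\<forall>j. \<rho> j > 0) \<and> \<rho> \<longlonglongrightarrow> 0 \<and>
         (\<lambda>j. infdist (x + \<rho> j *\<^sub>R h) K) \<in> o(\<rho>)}"

definition lineality :: "'a::ab_group_add set \<Rightarrow> 'a set" where
  "lineality C = C \<inter> uminus ` C"

text \<open>
  The one-sided directional derivative. \<^const>\<open>Lim\<close> is unspecified where the limit does not
  exist; for a convex \<open>f\<close>, such as the Ky Fan norm, it always exists.
\<close>
definition dir_deriv :: "('a::real_normed_vector \<Rightarrow> real) \<Rightarrow> 'a \<Rightarrow> 'a \<Rightarrow> real" where
  "dir_deriv f x h = Lim (at_right 0) (\<lambda>t. (f (x + t *\<^sub>R h) - f x) / t)"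

definition T_lin :: "('a::real_normed_vector \<Rightarrow> real) \<Rightarrow> 'a \<Rightarrow> 'a set" where
  "T_lin f x = {h. dir_deriv f x h = - dir_deriv f x (- h)}"

definition continuously_differentiable ::
    "('a::real_normed_vector \<Rightarrow> 'b::real_normed_vector) \<Rightarrow> bool" where
  "continuously_differentiable f \<longleftrightarrow>
     (\<exists>f' :: 'a \<Rightarrow> 'a \<Rightarrow>\<^sub>L 'b.
        (\<forall>x. (f has_derivative blinfun_apply (f' x)) (at x)) \<and> continuous_on UNIV f')"

end

theory Submission
  imports Defs
begin

text \<open>
  The Ky Fan norm \<open>\<theta>\<close> enters only through the fact that it is sublinear and Lipschitz. For such a
  function the difference quotients decrease as the step shrinks and stay bounded below, so \<open>\<theta>'(X; \<cdot>)\<close> exists, and the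
  tangent cone of \<open>epi \<theta>\<close> at \<open>(X, \<theta> X)\<close> is the epigraph of \<open>\<theta>'(X; \<cdot>)\<close>. Convexity gives
  \<open>\<theta>'(X; H) + \<theta>'(X; -H) \<ge> 0\<close>, so the lineality space of that cone, the set of \<open>(H, \<tau>)\<close> with
  \<open>\<theta>'(X; H) \<le> \<tau> \<le> - \<theta>'(X; -H)\<close>, is the graph of \<open>\<theta>'(X; \<cdot>)\<close> over \<open>T_lin \<theta> X\<close>. The range of
  \<open>G'\<close> is \<open>range g' \<times> \<real>\<close>: the last coordinate is free, hence whether the sum with a graph over
  \<open>T_lin \<theta> X\<close> fills the product space is decided in the matrix coordinate alone.

  Sublinearity of \<open>\<theta>\<close>, which is defined through roots of a characteristic polynomial, comes from
  Ky Fan's maximum principle: \<open>\<theta> Z\<close> is the maximum of \<open>\<Sum>i\<in>I. a i \<bullet> Z (b i)\<close> over index sets of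
  size \<open>k\<close> and orthogonal families \<open>a\<close>, \<open>b\<close> of vectors of norm at most \<open>1\<close>
  (\<open>ky_fan_norm_upper\<close> and \<open>ky_fan_norm_attained\<close>). A maximum of linear functions is sublinear. The
  principle rests on a singular value decomposition, obtained from the spectral theorem for
  \<open>Z Z\<^sup>T\<close>. Allowing vectors shorter than \<open>1\<close> means that the right singular vectors belonging to the
  singular value \<open>0\<close> can be taken to be \<open>0\<close>, and no completion to an orthonormal basis is needed.
\<close>

section \<open>The spectral theorem for self-adjoint operators\<close>

text \<open>
  A maximiser of the Rayleigh quotient is an eigenvector: the form \<open>c \<parallel>y\<parallel>\<^sup>2 - y \<bullet> f y\<close> is nonnegative
  and vanishes at \<open>x\<close>, so its derivative at \<open>x\<close> in the direction of the residual \<open>f x - c x\<close> vanishes.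
\<close>
lemma rayleigh_maximiser_eigenvector:
  fixes f :: "'a::euclidean_space \<Rightarrow> 'a"
  assumes f: "linear f" and sa: "\<And>x y. f x \<bullet> y = x \<bullet> f y"
    and S: "subspace S" "f ` S \<subseteq> S" and x: "x \<in> S" "norm x = 1"
    and mx: "\<And>y. y \<in> S \<Longrightarrow> norm y = 1 \<Longrightarrow> y \<bullet> f y \<le> x \<bullet> f x"
  shows "f x = (x \<bullet> f x) *\<^sub>R x"
proof -
  define c where "c = x \<bullet> f x"
  define q where "q y = c * (y \<bullet> y) - y \<bullet> f y" for y
  have q_nonneg: "q y \<ge> 0" if "y \<in> S" for y
  proof (cases "y = 0")
    case True
    then show ?thesis using f by (simp add: q_def linear_0)
  next
    case False
    let ?z = "(1 / norm y) *\<^sub>R y"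
    have "?z \<bullet> f ?z \<le> c"
      unfolding c_def using that False S(1) by (intro mx) (auto simp: subspace_scale)
    moreover have "?z \<bullet> f ?z = (y \<bullet> f y) / (norm y)\<^sup>2"
      unfolding linear_scale[OF f] by (simp add: power2_eq_square)
    ultimately have "(y \<bullet> f y) / (norm y)\<^sup>2 \<le> c" by simp
    then show ?thesis
      using False by (simp add: q_def divide_le_eq power2_norm_eq_inner)
  qed
  define w where "w = f x - c *\<^sub>R x"
  have wS: "w \<in> S"
    using S x unfolding w_def by (intro subspace_diff subspace_scale) auto
  have exp: "q (x + t *\<^sub>R w) = - 2 * t * (w \<bullet> w) + t\<^sup>2 * q w" for t
  proof -
    have xx: "x \<bullet> x = 1" using x by (simp add: norm_eq_1)
    have fw: "x \<bullet> f w = f x \<bullet> w" using sa by simp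
    have fx: "f x = w + c *\<^sub>R x" by (simp add: w_def)
    have xf: "x \<bullet> f x = c" by (simp add: c_def)
    have "q (x + t *\<^sub>R w) = c * (x \<bullet> x + 2 * t * (x \<bullet> w) + t\<^sup>2 * (w \<bullet> w))
        - (x \<bullet> f x + t * (x \<bullet> f w) + t * (w \<bullet> f x) + t\<^sup>2 * (w \<bullet> f w))"
      using f unfolding q_def
      by (simp add: linear_add linear_scale inner_add_left inner_add_right inner_commute[of w x]
          power2_eq_square algebra_simps)
    also have "\<dots> = 2 * t * c * (x \<bullet> w) - 2 * t * (f x \<bullet> w) + t\<^sup>2 * q w"
      unfolding fw xf xx q_def by (simp add: inner_commute[of w "f x"] algebra_simps)
    also have "f x \<bullet> w = w \<bullet> w + c * (x \<bullet> w)"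
      by (subst fx) (simp add: inner_add_left)
    finally show ?thesis by (simp add: algebra_simps)
  qed
  have nonneg: "- 2 * t * (w \<bullet> w) + t\<^sup>2 * q w \<ge> 0" for t
    using q_nonneg[of "x + t *\<^sub>R w"] S x wS exp
    by (metis subspace_add subspace_scale)
  have "w \<bullet> w = 0"
  proof (cases "q w = 0")
    case True
    then show ?thesis using nonneg[of 1] inner_ge_zero[of w] by simp
  next
    case False
    \<comment> \<open>The minimiser of the quadratic polynomial in \<open>t\<close> makes it negative unless \<open>w = 0\<close>.\<close>
    have "- 2 * (w \<bullet> w / q w) * (w \<bullet> w) + (w \<bullet> w / q w)\<^sup>2 * q w = - ((w \<bullet> w)\<^sup>2 / q w)"
      using False by (simp add: field_simps power2_eq_square)
    with nonneg[of "w \<bullet> w / q w"] have "(w \<bullet> w)\<^sup>2 / q w \<le> 0" by simp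
    moreover have "q w > 0" using False q_nonneg[OF wS] by simp
    ultimately show ?thesis by (simp add: divide_le_0_iff)
  qed
  then show ?thesis by (simp add: w_def c_def)
qed

text \<open>
  Induction on the dimension: the orthogonal complement of an eigenvector within \<open>S\<close> is again
  invariant, because \<open>f\<close> is self-adjoint.
\<close>
lemma self_adjoint_orthonormal_eigenbasis:
  fixes f :: "'a::euclidean_space \<Rightarrow> 'a"
  assumes f: "linear f" and sa: "\<And>x y. f x \<bullet> y = x \<bullet> f y"
    and S: "subspace S" "f ` S \<subseteq> S"
  shows "\<exists>B\<subseteq>S. pairwise orthogonal B \<and> span B = S \<and>
    (\<forall>b\<in>B. norm b = 1 \<and> f b = (b \<bullet> f b) *\<^sub>R b)"
  using S
proof (induction "dim S" arbitrary: S rule: less_induct)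
  case less
  show ?case
  proof (cases "S \<subseteq> {0}")
    case True
    then have "S = {0}" using less.prems(1) subspace_0 by blast
    then show ?thesis by (intro exI[of _ "{}"]) (auto simp: pairwise_def)
  next
    case False
    then obtain z where z: "z \<in> S" "z \<noteq> 0" by auto
    have cpt: "compact (S \<inter> sphere 0 1)"
      using closed_subspace[OF less.prems(1)] by (intro closed_Int_compact) auto
    have ne: "S \<inter> sphere 0 1 \<noteq> {}"
    proof -
      have "(1 / norm z) *\<^sub>R z \<in> S \<inter> sphere 0 1"
        using z less.prems(1) by (simp add: subspace_scale)
      then show ?thesis by blast
    qed
    have cont: "continuous_on (S \<inter> sphere 0 1) (\<lambda>y. y \<bullet> f y)"
      using f by (intro continuous_intros linear_continuous_on) (auto simp: linear_linear)
    from continuous_attains_sup[OF cpt ne cont] obtain x where x: "x \<in> S" "norm x = 1"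
      and mx: "\<And>y. y \<in> S \<Longrightarrow> norm y = 1 \<Longrightarrow> y \<bullet> f y \<le> x \<bullet> f x"
      by auto
    have ev: "f x = (x \<bullet> f x) *\<^sub>R x"
      using rayleigh_maximiser_eigenvector[OF f sa less.prems x mx] .
    have xx: "x \<bullet> x = 1" using x by (simp add: norm_eq_1)
    define S' where "S' = S \<inter> {y. x \<bullet> y = 0}"
    have sub': "subspace S'"
      unfolding S'_def using less.prems(1) subspace_hyperplane by (intro subspace_inter) auto
    have inv': "f ` S' \<subseteq> S'"
    proof -
      have "x \<bullet> f y = 0" if "x \<bullet> y = 0" for y
        using sa[of x y] that ev by (metis inner_scaleR_left mult_zero_right)
      then show ?thesis using less.prems(2) by (auto simp: S'_def)
    qed
    have "x \<notin> S'" using xx by (simp add: S'_def)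
    then have "S' \<subset> S" using x(1) unfolding S'_def by blast
    then have "dim S' < dim S"
      using sub' less.prems(1) by (intro dim_psubset) (simp add: span_eq_iff[THEN iffD2])
    from less.hyps[OF this sub' inv'] obtain B where B: "B \<subseteq> S'" "pairwise orthogonal B"
      "span B = S'" "\<forall>b\<in>B. norm b = 1 \<and> f b = (b \<bullet> f b) *\<^sub>R b" by blast
    have "span (insert x B) = S"
    proof
      show "span (insert x B) \<subseteq> S"
        using B(1) x less.prems(1) by (intro span_minimal) (auto simp: S'_def)
      show "S \<subseteq> span (insert x B)"
      proof
        fix y assume y: "y \<in> S"
        have "y - (x \<bullet> y) *\<^sub>R x \<in> span B"
          unfolding B(3) S'_def using y x less.prems(1) xx
          by (auto simp: inner_diff_right subspace_diff subspace_scale)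
        then show "y \<in> span (insert x B)"
          unfolding span_insert by blast
      qed
    qed
    moreover have "pairwise orthogonal (insert x B)"
      using B(1,2) by (auto simp: pairwise_insert orthogonal_def S'_def inner_commute)
    ultimately show ?thesis
      using B x ev by (intro exI[of _ "insert x B"]) (auto simp: S'_def)
  qed
qed

lemma symmetric_matrix_eigenvectors:
  fixes A :: "real ^ 'm ^ 'm"
  assumes sym: "transpose A = A"
  obtains u :: "'m \<Rightarrow> real ^ 'm" and d :: "'m \<Rightarrow> real"
  where "\<And>i j. u i \<bullet> u j = (if i = j then 1 else 0)" "\<And>i. A *v u i = d i *\<^sub>R u i"
    "span (range u) = UNIV"
proof -
  have sa: "(A *v x) \<bullet> y = x \<bullet> (A *v y)" for x y
    by (metis dot_lmul_matrix sym transpose_matrix_vector)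
  obtain B where B: "pairwise orthogonal B" "span B = UNIV"
    "\<And>b. b \<in> B \<Longrightarrow> norm b = 1" "\<And>b. b \<in> B \<Longrightarrow> A *v b = (b \<bullet> (A *v b)) *\<^sub>R b"
    using self_adjoint_orthonormal_eigenbasis[OF matrix_vector_mul_linear, of A UNIV] sa by auto
  have ind: "independent B"
    using B(1) B(3)[of 0] by (intro pairwise_orthogonal_independent) auto
  have "card B = CARD('m)"
    using dim_span_eq_card_independent[OF ind] B(2) by (simp add: dim_UNIV)
  moreover have "finite B" using ind by (rule independent_imp_finite)
  ultimately obtain u :: "'m \<Rightarrow> real ^ 'm" where u: "bij_betw u UNIV B"
    using finite_same_card_bij[of "UNIV :: 'm set" B] by auto
  have uB: "u i \<in> B" for i using u by (auto simp: bij_betw_def)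
  show ?thesis
  proof
    show "u i \<bullet> u j = (if i = j then 1 else 0)" for i j
    proof (cases "i = j")
      case True
      then show ?thesis using B(3)[OF uB] by (simp add: norm_eq_1)
    next
      case False
      then have "u i \<noteq> u j" using u by (auto simp: bij_betw_def inj_on_def)
      then show ?thesis using B(1) uB False by (auto simp: pairwise_def orthogonal_def)
    qed
    show "A *v u i = (u i \<bullet> (A *v u i)) *\<^sub>R u i" for i using B(4) uB .
    show "span (range u) = UNIV" using u B(2) by (simp add: bij_betw_def)
  qed
qed

section \<open>Singular values\<close>

lemma map_matrix_const_poly_mult:
  fixes A :: "'a::comm_ring_1 ^ 'n ^ 'm" and B :: "'a ^ 'p ^ 'n"
  shows "map_matrix (\<lambda>a. [:a:]) (A ** B) = map_matrix (\<lambda>a. [:a:]) A ** map_matrix (\<lambda>a. [:a:]) B"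
proof -
  have "[:\<Sum>i\<in>I. h i:] = (\<Sum>i\<in>I. [:h i:])" for I :: "'n set" and h :: "'n \<Rightarrow> 'a"
    by (simp add: poly_eq_iff coeff_sum coeff_pCons split: nat.split)
  then show ?thesis
    by (simp add: vec_eq_iff matrix_matrix_mult_def mult.commute)
qed

lemma char_poly_diagonal:
  fixes d :: "'m::finite \<Rightarrow> real"
  shows "char_poly (\<chi> i j. if i = j then d i else 0) = (\<Prod>i\<in>UNIV. [:- d i, 1:])"
  unfolding char_poly_def by (subst det_diagonal) (auto simp: mat_def)

text \<open>
  With the eigenvectors as the columns of \<open>P\<close> the equation \<open>A P = P D\<close> lifts to polynomial matrices,
  \<open>(x - A) P = P (x - D)\<close>, and \<open>det P\<close> cancels because \<open>P\<^sup>T P\<close> is the identity.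
\<close>
lemma char_poly_eigenvectors:
  fixes A :: "real ^ 'm ^ 'm" and u :: "'m \<Rightarrow> real ^ 'm"
  assumes u: "\<And>i j. u i \<bullet> u j = (if i = j then 1 else 0)"
    and ev: "\<And>i. A *v u i = d i *\<^sub>R u i"
  shows "char_poly A = (\<Prod>i\<in>UNIV. [:- d i, 1:])"
proof -
  let ?C = "\<lambda>M :: real^'m^'m. map_matrix (\<lambda>a. [:a:]) M"
  let ?X = "mat [:0, 1:] :: real poly ^ 'm ^ 'm"
  define P :: "real ^ 'm ^ 'm" where "P = (\<chi> i j. u j $ i)"
  define D :: "real ^ 'm ^ 'm" where "D = (\<chi> i j. if i = j then d i else 0)"
  have PP: "transpose P ** P = mat 1"
    using u by (simp add: vec_eq_iff P_def matrix_matrix_mult_def transpose_def mat_def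
        inner_vec_def)
  have AP: "A ** P = P ** D"
  proof -
    have "(\<Sum>k\<in>UNIV. A $ i $ k * u j $ k) = d j * u j $ i" for i j
      using arg_cong[OF ev[of j], of "\<lambda>v. v $ i"] by (simp add: matrix_vector_mult_def)
    then show ?thesis
      by (simp add: vec_eq_iff P_def D_def matrix_matrix_mult_def if_distrib[of "\<lambda>x. _ * x"]
          cong: if_cong)
  qed
  have X: "?X ** ?C P = ?C P ** ?X"
    by (simp add: vec_eq_iff matrix_matrix_mult_def mat_def if_distrib[of "\<lambda>x. _ * x"]
        if_distrib[of "\<lambda>x. x * _"] if_distrib[of "smult _"] cong: if_cong)
  have "(M - N) ** Q = M ** Q - N ** Q" "Q ** (M - N) = Q ** M - Q ** N"
    for M N Q :: "real poly ^ 'm ^ 'm"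
    by (simp_all add: vec_eq_iff matrix_matrix_mult_def sum_subtractf algebra_simps)
  then have "(?X - ?C A) ** ?C P = ?C P ** (?X - ?C D)"
    using X AP map_matrix_const_poly_mult[of A P] map_matrix_const_poly_mult[of P D] by simp
  then have "det (?X - ?C A) * det (?C P) = det (?C P) * det (?X - ?C D)"
    by (metis det_mul)
  moreover have "det (?C P) \<noteq> 0"
  proof
    assume z: "det (?C P) = 0"
    have "?C (transpose P) ** ?C P = mat 1"
      using PP by (simp flip: map_matrix_const_poly_mult) (simp add: vec_eq_iff mat_def)
    then have "det (?C (transpose P)) * det (?C P) = 1"
      by (metis det_mul det_I)
    with z show False by simp
  qed
  ultimately have "char_poly A = char_poly D" by (simp add: char_poly_def)
  then show ?thesis by (simp add: D_def char_poly_diagonal)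
qed

text \<open>
  The right singular vectors are the normalised images \<open>Z\<^sup>T u i\<close> of the eigenvectors of \<open>Z Z\<^sup>T\<close>. When
  \<open>s i = 0\<close> this image is \<open>0\<close> and so is \<open>v i\<close>, which is why \<open>v i\<close> is only bounded by \<open>1\<close> in norm.
\<close>
lemma singular_value_decomposition:
  fixes Z :: "real ^ 'n ^ 'm"
  obtains u :: "'m \<Rightarrow> real ^ 'm" and v :: "'m \<Rightarrow> real ^ 'n" and s :: "'m \<Rightarrow> real"
  where "\<And>i j. u i \<bullet> u j = (if i = j then 1 else 0)" "span (range u) = UNIV"
    "\<And>i. norm (v i) \<le> 1" "\<And>i j. i \<noteq> j \<Longrightarrow> v i \<bullet> v j = 0"
    "\<And>i. s i \<ge> 0" "\<And>i. transpose Z *v u i = s i *\<^sub>R v i" "\<And>i. s i \<noteq> 0 \<Longrightarrow> norm (v i) = 1"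
    "singular_values Z = rev (sorted_list_of_multiset (image_mset s (mset_set UNIV)))"
proof -
  define A where "A = Z ** transpose Z"
  have sym: "transpose A = A"
    by (simp add: A_def matrix_transpose_mul)
  obtain u :: "'m \<Rightarrow> real ^ 'm" and d where u: "\<And>i j. u i \<bullet> u j = (if i = j then 1 else 0)"
    and ev: "\<And>i. A *v u i = d i *\<^sub>R u i" and sp: "span (range u) = UNIV"
    by (rule symmetric_matrix_eigenvectors[OF sym]) blast
  have gram: "(transpose Z *v u i) \<bullet> (transpose Z *v u j) = (if i = j then d i else 0)" for i j
  proof -
    have "(transpose Z *v u i) \<bullet> (transpose Z *v u j) = u i \<bullet> (A *v u j)"
      by (simp add: A_def dot_lmul_matrix transpose_matrix_vector flip: matrix_vector_mul_assoc)
    then show ?thesis by (simp add: ev u)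
  qed
  have d: "d i = (norm (transpose Z *v u i))\<^sup>2" for i
    using gram[of i i] by (simp add: power2_norm_eq_inner)
  have d0: "d i \<ge> 0" for i by (simp add: d)
  define s where "s i = sqrt (d i)" for i
  have s: "s i = norm (transpose Z *v u i)" for i
    by (simp add: s_def d)
  define v where "v i = (1 / s i) *\<^sub>R (transpose Z *v u i)" for i
  show ?thesis
  proof
    show "u i \<bullet> u j = (if i = j then 1 else 0)" for i j by (rule u)
    show "span (range u) = UNIV" by (rule sp)
    show "norm (v i) \<le> 1" for i by (simp add: v_def s)
    show "v i \<bullet> v j = 0" if "i \<noteq> j" for i j using gram[of i j] that by (simp add: v_def)
    show "s i \<ge> 0" for i by (simp add: s)
    show "transpose Z *v u i = s i *\<^sub>R v i" for i by (simp add: v_def s)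
    show "norm (v i) = 1" if "s i \<noteq> 0" for i using that by (simp add: v_def s)
    have "proots (char_poly A) = (\<Sum>i\<in>UNIV. {#d i#})"
      unfolding char_poly_eigenvectors[OF u ev] by (subst proots_prod) auto
    also have "\<dots> = image_mset d (mset_set UNIV)"
      by (simp add: sum_unfold_sum_mset)
    finally show "singular_values Z = rev (sorted_list_of_multiset (image_mset s (mset_set UNIV)))"
      by (simp add: singular_values_def A_def[symmetric] multiset.map_comp s_def[abs_def] comp_def)
  qed
qed

lemma sum_of_k_largest:
  fixes s :: "'m::finite \<Rightarrow> real"
  assumes k: "k \<le> CARD('m)"
  obtains I where "card I = k" "\<And>i j. i \<in> I \<Longrightarrow> j \<notin> I \<Longrightarrow> s j \<le> s i"
    "sum_list (take k (rev (sorted_list_of_multiset (image_mset s (mset_set UNIV))))) = sum s I"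
proof -
  obtain xs0 where xs0: "set xs0 = (UNIV :: 'm set)" "distinct xs0"
    using finite_distinct_list[OF finite] by blast
  define xs where "xs = sort_key s xs0"
  have xs: "set xs = UNIV" "distinct xs" "sorted (map s xs)"
    using xs0 by (auto simp: xs_def)
  have "mset (map s xs) = image_mset s (mset_set UNIV)"
    using xs(1,2) by (metis mset_map mset_set_set)
  then have L: "sorted_list_of_multiset (image_mset s (mset_set UNIV)) = map s xs"
    using xs(3) by (metis sorted_list_of_multiset_mset sorted_sort_id)
  define ys where "ys = rev xs"
  have ys: "set ys = UNIV" "distinct ys" "sorted_wrt (\<ge>) (map s ys)"
    using xs by (auto simp: ys_def sorted_wrt_rev simp flip: rev_map)
  have len: "length ys = CARD('m)"
    using ys(1,2) distinct_card by metis
  show ?thesis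
  proof
    show "card (set (take k ys)) = k"
      using ys(2) k len by (simp add: distinct_card)
    have srt: "sorted_wrt (\<ge>) (map s (take k ys) @ map s (drop k ys))"
      using ys(3) by (metis append_take_drop_id map_append)
    show "s j \<le> s i" if "i \<in> set (take k ys)" "j \<notin> set (take k ys)" for i j
    proof -
      have "j \<in> set (drop k ys)"
        using that(2) ys(1) by (metis UNIV_I Un_iff append_take_drop_id set_append)
      with srt that(1) show ?thesis by (simp add: sorted_wrt_append)
    qed
    show "sum_list (take k (rev (sorted_list_of_multiset (image_mset s (mset_set UNIV)))))
        = sum s (set (take k ys))"
      using ys(2) by (simp add: L rev_map ys_def[symmetric] take_map
          sum_list_distinct_conv_sum_set)
  qed
qed

section \<open>Ky Fan's maximum principle\<close>

text \<open>Bessel's inequality, for orthogonal vectors that may be shorter than \<open>1\<close>.\<close>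
lemma bessel_inequality:
  fixes a :: "'i \<Rightarrow> 'a::real_inner"
  assumes fin: "finite I" and n: "\<And>i. i \<in> I \<Longrightarrow> norm (a i) \<le> 1"
    and o: "\<And>i j. i \<in> I \<Longrightarrow> j \<in> I \<Longrightarrow> i \<noteq> j \<Longrightarrow> a i \<bullet> a j = 0"
  shows "(\<Sum>i\<in>I. (a i \<bullet> x)\<^sup>2) \<le> (norm x)\<^sup>2"
proof -
  define p where "p = (\<Sum>i\<in>I. (a i \<bullet> x) *\<^sub>R a i)"
  let ?c = "\<Sum>i\<in>I. (a i \<bullet> x)\<^sup>2"
  have xp: "x \<bullet> p = ?c"
    by (simp add: p_def inner_sum_right power2_eq_square inner_commute)
  have "p \<bullet> p = (\<Sum>i\<in>I. \<Sum>j\<in>I. (a i \<bullet> x) * (a j \<bullet> x) * (a i \<bullet> a j))"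
    by (simp add: p_def inner_sum_right inner_sum_left sum_distrib_left mult_ac inner_commute)
  also have "\<dots> = (\<Sum>i\<in>I. \<Sum>j\<in>I. if i = j then (a i \<bullet> x)\<^sup>2 * (norm (a i))\<^sup>2 else 0)"
    using o by (intro sum.cong) (auto simp: power2_eq_square power2_norm_eq_inner[symmetric]
        simp flip: power2_norm_eq_inner)
  also have "\<dots> = (\<Sum>i\<in>I. (a i \<bullet> x)\<^sup>2 * (norm (a i))\<^sup>2)"
    using fin by simp
  also have "\<dots> \<le> ?c"
    using n by (intro sum_mono mult_left_le) (auto simp: power_le_one)
  finally have "p \<bullet> p \<le> ?c" .
  moreover have "0 \<le> (x - p) \<bullet> (x - p)" by simp
  ultimately show ?thesis
    using xp by (simp add: inner_diff_left inner_diff_right inner_commute power2_norm_eq_inner)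
qed

text \<open>
  Weights in \<open>[0, 1]\<close> of total at most \<open>card I\<close> are best spent on the largest values: every unit of
  weight missing on \<open>I\<close> costs at least the threshold \<open>t\<close> that separates \<open>I\<close> from its complement,
  and every unit placed elsewhere earns at most \<open>t\<close>.
\<close>
lemma weighted_sum_le_sum_of_largest:
  fixes s c :: "'m::finite \<Rightarrow> real"
  assumes s: "\<And>i. s i \<ge> 0" and I: "\<And>i j. i \<in> I \<Longrightarrow> j \<notin> I \<Longrightarrow> s j \<le> s i"
    and c: "\<And>i. 0 \<le> c i" "\<And>i. c i \<le> 1" "sum c UNIV \<le> real (card I)"
  shows "(\<Sum>i\<in>UNIV. s i * c i) \<le> sum s I"
proof -
  obtain t where t: "t \<ge> 0" "\<And>i. i \<in> I \<Longrightarrow> t \<le> s i" "\<And>j. j \<notin> I \<Longrightarrow> s j \<le> t"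
  proof (cases "- I = {}")
    case True
    then show ?thesis using s that[of 0] by auto
  next
    case False
    then show ?thesis
      using s I by (intro that[of "Max (s ` (- I))"]) (auto simp: Max_ge_iff)
  qed
  have "(\<Sum>i\<in>UNIV. s i * c i) \<le> (\<Sum>i\<in>UNIV. t * c i + (if i \<in> I then s i - t else 0))"
  proof (rule sum_mono)
    fix i
    show "s i * c i \<le> t * c i + (if i \<in> I then s i - t else 0)"
    proof (cases "i \<in> I")
      case True
      then have "(s i - t) * c i \<le> s i - t"
        using t(2)[of i] c by (intro mult_left_le) auto
      then show ?thesis using True by (simp add: algebra_simps)
    next
      case False
      then show ?thesis using t(3)[of i] c by (simp add: mult_right_mono)
    qed
  qed
  also have "\<dots> = t * sum c UNIV + (sum s I - real (card I) * t)"
    by (simp add: sum.distrib sum_distrib_left sum.If_cases sum_subtractf)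
  also have "\<dots> \<le> sum s I"
    using mult_left_mono[OF c(3) t(1)] by (simp add: mult.commute)
  finally show ?thesis .
qed

text \<open>The first \<open>k\<close> pairs of singular vectors attain the maximum.\<close>
lemma ky_fan_norm_attained:
  fixes Z :: "real ^ 'n ^ 'm"
  assumes k: "k \<le> CARD('m)"
  obtains I :: "'m set" and a :: "'m \<Rightarrow> real ^ 'm" and b :: "'m \<Rightarrow> real ^ 'n"
  where "card I = k" "\<And>i. norm (a i) \<le> 1" "\<And>i j. i \<noteq> j \<Longrightarrow> a i \<bullet> a j = 0"
    "\<And>i. norm (b i) \<le> 1" "\<And>i j. i \<noteq> j \<Longrightarrow> b i \<bullet> b j = 0"
    "ky_fan_norm k Z = (\<Sum>i\<in>I. a i \<bullet> (Z *v b i))"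
proof -
  obtain u :: "'m \<Rightarrow> real ^ 'm" and v :: "'m \<Rightarrow> real ^ 'n" and s
    where u: "\<And>i j. u i \<bullet> u j = (if i = j then 1 else 0)"
      and v: "\<And>i. norm (v i) \<le> 1" "\<And>i j. i \<noteq> j \<Longrightarrow> v i \<bullet> v j = 0"
        "\<And>i. transpose Z *v u i = s i *\<^sub>R v i" "\<And>i. s i \<noteq> 0 \<Longrightarrow> norm (v i) = 1"
      and sv: "singular_values Z = rev (sorted_list_of_multiset (image_mset s (mset_set UNIV)))"
    by (rule singular_value_decomposition[of Z]) blast
  obtain I where I: "card I = k"
    "sum_list (take k (rev (sorted_list_of_multiset (image_mset s (mset_set UNIV))))) = sum s I"
    by (rule sum_of_k_largest[OF k, of s]) blast
  have "u i \<bullet> (Z *v v i) = s i" for i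
  proof -
    have "u i \<bullet> (Z *v v i) = s i * (v i \<bullet> v i)"
      using v(3)[of i] by (simp add: transpose_matrix_vector flip: dot_lmul_matrix)
    then show ?thesis using v(4)[of i] by (cases "s i = 0") (auto simp: norm_eq_1)
  qed
  then have "ky_fan_norm k Z = (\<Sum>i\<in>I. u i \<bullet> (Z *v v i))"
    using I(2) by (simp add: ky_fan_norm_def sv)
  moreover have "norm (u i) \<le> 1" for i using u[of i i] by (simp add: norm_eq_1[symmetric])
  ultimately show ?thesis using that[OF I(1), of u v] u v by auto
qed

text \<open>
  Expanding \<open>a i\<close> in the left singular vectors turns the left-hand side into \<open>\<Sum>j. s j * c j\<close> with
  \<open>c j = (\<Sum>i\<in>I. (a i \<bullet> u j) * (v j \<bullet> b i))\<close>. By the inequality between the arithmetic and geometric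
  means, \<open>c j\<close> is at most the average of two sums of squares. Bessel's inequality for the families
  \<open>a\<close>, \<open>b\<close> bounds this average by \<open>1\<close>, and Bessel's inequality for \<open>u\<close>, \<open>v\<close> bounds its sum over \<open>j\<close>
  by \<open>card I\<close>.
\<close>
lemma ky_fan_norm_upper:
  fixes Z :: "real ^ 'n ^ 'm" and I :: "'m set"
  assumes I: "card I = k"
    and a: "\<And>i. norm (a i) \<le> 1" "\<And>i j. i \<noteq> j \<Longrightarrow> a i \<bullet> a j = 0"
    and b: "\<And>i. norm (b i) \<le> 1" "\<And>i j. i \<noteq> j \<Longrightarrow> b i \<bullet> b j = 0"
  shows "(\<Sum>i\<in>I. a i \<bullet> (Z *v b i)) \<le> ky_fan_norm k Z"
proof -
  obtain u :: "'m \<Rightarrow> real ^ 'm" and v :: "'m \<Rightarrow> real ^ 'n" and s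
    where u: "\<And>i j. u i \<bullet> u j = (if i = j then 1 else 0)" "span (range u) = UNIV"
      and v: "\<And>i. norm (v i) \<le> 1" "\<And>i j. i \<noteq> j \<Longrightarrow> v i \<bullet> v j = 0"
        "\<And>i. s i \<ge> 0" "\<And>i. transpose Z *v u i = s i *\<^sub>R v i"
      and sv: "singular_values Z = rev (sorted_list_of_multiset (image_mset s (mset_set UNIV)))"
    by (rule singular_value_decomposition[of Z]) blast
  have "k \<le> CARD('m)" using I card_mono[of UNIV I] by simp
  then obtain J where J: "card J = k" "\<And>i j. i \<in> J \<Longrightarrow> j \<notin> J \<Longrightarrow> s j \<le> s i"
    "sum_list (take k (rev (sorted_list_of_multiset (image_mset s (mset_set UNIV))))) = sum s J"
    using sum_of_k_largest[of k s] by blast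
  have nu: "norm (u i) \<le> 1" for i using u(1)[of i i] by (simp add: norm_eq_1[symmetric])
  have expand: "x = (\<Sum>j\<in>UNIV. (x \<bullet> u j) *\<^sub>R u j)" for x
  proof -
    let ?r = "x - (\<Sum>j\<in>UNIV. (x \<bullet> u j) *\<^sub>R u j)"
    have "(\<Sum>i\<in>UNIV. (x \<bullet> u i) * (u i \<bullet> u j)) = (\<Sum>i\<in>UNIV. if i = j then x \<bullet> u j else 0)" for j
      by (intro sum.cong) (auto simp: u(1))
    then have "?r \<bullet> u j = 0" for j
      by (simp add: inner_diff_left inner_sum_left)
    then have "orthogonal ?r y" if "y \<in> range u" for y
      using that by (auto simp: orthogonal_def)
    then have "orthogonal ?r ?r" using orthogonal_to_span[of ?r "range u" ?r] unfolding u(2) by blast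
    then show ?thesis by (simp add: orthogonal_self)
  qed
  have expand_form: "a i \<bullet> (Z *v b i) = (\<Sum>j\<in>UNIV. s j * ((a i \<bullet> u j) * (v j \<bullet> b i)))" for i
  proof -
    have "u j \<bullet> (Z *v b i) = s j * (v j \<bullet> b i)" for j
      using v(4)[of j] by (simp add: transpose_matrix_vector flip: dot_lmul_matrix)
    then show ?thesis
      by (subst expand[of "a i"]) (simp add: inner_sum_left mult_ac)
  qed
  define c where "c j = (\<Sum>i\<in>I. ((a i \<bullet> u j)\<^sup>2 + (b i \<bullet> v j)\<^sup>2) / 2)" for j
  have "(\<Sum>i\<in>I. a i \<bullet> (Z *v b i)) = (\<Sum>j\<in>UNIV. s j * (\<Sum>i\<in>I. (a i \<bullet> u j) * (v j \<bullet> b i)))"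
    unfolding expand_form by (subst sum.swap) (simp add: sum_distrib_left)
  also have "\<dots> \<le> (\<Sum>j\<in>UNIV. s j * c j)"
  proof (intro sum_mono mult_left_mono)
    fix j
    have "x * y \<le> (x\<^sup>2 + y\<^sup>2) / 2" for x y :: real
      using sum_squares_bound[of x y] by simp
    then show "(\<Sum>i\<in>I. (a i \<bullet> u j) * (v j \<bullet> b i)) \<le> c j"
      unfolding c_def by (intro sum_mono) (simp add: inner_commute[of "v j"])
  qed (use v(3) in auto)
  also have "\<dots> \<le> sum s J"
  proof (rule weighted_sum_le_sum_of_largest)
    show "0 \<le> c j" for j by (auto simp: c_def intro!: sum_nonneg)
    show "c j \<le> 1" for j
    proof -
      have "(\<Sum>i\<in>I. (a i \<bullet> u j)\<^sup>2) \<le> (norm (u j))\<^sup>2" "(\<Sum>i\<in>I. (b i \<bullet> v j)\<^sup>2) \<le> (norm (v j))\<^sup>2"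
        using a b by (auto intro!: bessel_inequality)
      moreover have "(norm (u j))\<^sup>2 \<le> 1" "(norm (v j))\<^sup>2 \<le> 1"
        using nu v(1) by (auto simp: power_le_one)
      ultimately show ?thesis
        by (simp add: c_def sum.distrib flip: sum_divide_distrib)
    qed
    have "((\<Sum>j\<in>UNIV. (a i \<bullet> u j)\<^sup>2) + (\<Sum>j\<in>UNIV. (b i \<bullet> v j)\<^sup>2)) / 2 \<le> 1" for i
    proof -
      have "(\<Sum>j\<in>UNIV. (u j \<bullet> a i)\<^sup>2) \<le> (norm (a i))\<^sup>2" "(\<Sum>j\<in>UNIV. (v j \<bullet> b i)\<^sup>2) \<le> (norm (b i))\<^sup>2"
        using u nu v by (auto intro!: bessel_inequality)
      moreover have "(norm (a i))\<^sup>2 \<le> 1" "(norm (b i))\<^sup>2 \<le> 1"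
        using a b by (auto simp: power_le_one)
      ultimately show ?thesis by (simp add: inner_commute)
    qed
    then have "(\<Sum>i\<in>I. ((\<Sum>j\<in>UNIV. (a i \<bullet> u j)\<^sup>2) + (\<Sum>j\<in>UNIV. (b i \<bullet> v j)\<^sup>2)) / 2) \<le> (\<Sum>i\<in>I. 1)"
      by (intro sum_mono)
    also have "(\<Sum>i\<in>I. ((\<Sum>j\<in>UNIV. (a i \<bullet> u j)\<^sup>2) + (\<Sum>j\<in>UNIV. (b i \<bullet> v j)\<^sup>2)) / 2) = sum c UNIV"
      unfolding c_def by (subst sum.swap) (simp add: sum.distrib flip: sum_divide_distrib)
    finally show "sum c UNIV \<le> real (card J)" using I J(1) by simp
  qed (use v(3) J(2) in auto)
  also have "\<dots> = ky_fan_norm k Z" using J(3) by (simp add: ky_fan_norm_def sv)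
  finally show ?thesis .
qed

lemma ky_fan_norm_add:
  fixes Y Z :: "real ^ 'n ^ 'm"
  assumes "k \<le> CARD('m)"
  shows "ky_fan_norm k (Y + Z) \<le> ky_fan_norm k Y + ky_fan_norm k Z"
proof -
  obtain I :: "'m set" and a b where w: "card I = k" "\<And>i. norm (a i) \<le> 1" "\<And>i j. i \<noteq> j \<Longrightarrow> a i \<bullet> a j = 0"
    "\<And>i. norm (b i) \<le> 1" "\<And>i j. i \<noteq> j \<Longrightarrow> b i \<bullet> b j = 0"
    and eq: "ky_fan_norm k (Y + Z) = (\<Sum>i\<in>I. a i \<bullet> ((Y + Z) *v b i))"
    by (rule ky_fan_norm_attained[OF assms, of "Y + Z"]) blast
  have le: "(\<Sum>i\<in>I. a i \<bullet> (X *v b i)) \<le> ky_fan_norm k X" for X :: "real ^ 'n ^ 'm"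
    using w by (rule ky_fan_norm_upper)
  have "ky_fan_norm k (Y + Z) = (\<Sum>i\<in>I. a i \<bullet> (Y *v b i)) + (\<Sum>i\<in>I. a i \<bullet> (Z *v b i))"
    unfolding eq by (simp add: matrix_vector_mult_add_rdistrib inner_add_right sum.distrib)
  then show ?thesis
    using le[of Y] le[of Z] by linarith
qed

lemma ky_fan_norm_scaleR_le:
  fixes Z :: "real ^ 'n ^ 'm"
  assumes "k \<le> CARD('m)" "c \<ge> 0"
  shows "ky_fan_norm k (c *\<^sub>R Z) \<le> c * ky_fan_norm k Z"
proof -
  obtain I :: "'m set" and a b where w: "card I = k" "\<And>i. norm (a i) \<le> 1" "\<And>i j. i \<noteq> j \<Longrightarrow> a i \<bullet> a j = 0"
    "\<And>i. norm (b i) \<le> 1" "\<And>i j. i \<noteq> j \<Longrightarrow> b i \<bullet> b j = 0"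
    and eq: "ky_fan_norm k (c *\<^sub>R Z) = (\<Sum>i\<in>I. a i \<bullet> ((c *\<^sub>R Z) *v b i))"
    by (rule ky_fan_norm_attained[OF assms(1), of "c *\<^sub>R Z"]) blast
  have le: "(\<Sum>i\<in>I. a i \<bullet> (X *v b i)) \<le> ky_fan_norm k X" for X :: "real ^ 'n ^ 'm"
    using w by (rule ky_fan_norm_upper)
  have "ky_fan_norm k (c *\<^sub>R Z) = c * (\<Sum>i\<in>I. a i \<bullet> (Z *v b i))"
    unfolding eq by (simp add: scaleR_matrix_vector_assoc[symmetric] sum_distrib_left)
  then show ?thesis
    using mult_left_mono[OF le[of Z] assms(2)] by simp
qed

lemma ky_fan_norm_bounded:
  assumes "k \<le> CARD('m)"
  obtains L where "L \<ge> 0" "\<And>Z :: real ^ 'n ^ 'm. ky_fan_norm k Z \<le> L * norm Z"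
proof -
  obtain M where M: "\<And>(Z :: real ^ 'n ^ 'm) (x :: real ^ 'n). norm (Z *v x) \<le> norm Z * norm x * M"
    "M > 0"
  proof -
    have "bounded_bilinear (\<lambda>(Z :: real ^ 'n ^ 'm) (x :: real ^ 'n). Z *v x)"
      by (rule bilinear_conv_bounded_bilinear[THEN iffD1])
        (auto simp: bilinear_def matrix_vector_right_distrib matrix_vector_mult_add_rdistrib
          scaleR_matrix_vector_assoc[symmetric] matrix_vector_mult_scaleR intro!: linearI)
    then show ?thesis using that bounded_bilinear.pos_bounded by blast
  qed
  show ?thesis
  proof
    show "real k * M \<ge> 0" using M(2) by simp
    fix Z :: "real ^ 'n ^ 'm"
    obtain I :: "'m set" and a b where w: "card I = k" "\<And>i. norm (a i) \<le> 1" "\<And>i. norm (b i) \<le> 1"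
      and eq: "ky_fan_norm k Z = (\<Sum>i\<in>I. a i \<bullet> (Z *v b i))"
      by (rule ky_fan_norm_attained[OF assms, of Z]) blast
    have "a i \<bullet> (Z *v b i) \<le> norm Z * M" for i
    proof -
      have "a i \<bullet> (Z *v b i) \<le> norm (a i) * norm (Z *v b i)"
        by (rule norm_cauchy_schwarz)
      also have "\<dots> \<le> 1 * norm (Z *v b i)"
        using w(2) by (intro mult_right_mono) auto
      also have "\<dots> \<le> norm Z * norm (b i) * M" using M(1)[of Z "b i"] by simp
      also have "\<dots> \<le> norm Z * 1 * M"
        using w(3) M(2) by (intro mult_right_mono mult_left_mono) auto
      finally show ?thesis by simp
    qed
    then have "ky_fan_norm k Z \<le> real (card I) * (norm Z * M)"
      unfolding eq by (intro sum_bounded_above) auto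
    then show "ky_fan_norm k Z \<le> (real k * M) * norm Z" using w(1) by (simp add: mult_ac)
  qed
qed

section \<open>Directional derivatives and epigraphs of sublinear functions\<close>

text \<open>
  One inequality suffices in \<open>scale\<close>: for \<open>c > 0\<close> the other one is the same statement for \<open>1 / c\<close>.
  The one-sided \<open>bound\<close> is a Lipschitz condition in disguise, by subadditivity.
\<close>
locale bounded_sublinear =
  fixes f :: "'a::real_normed_vector \<Rightarrow> real" and L :: real
  assumes add: "f (x + y) \<le> f x + f y"
    and scale: "c \<ge> 0 \<Longrightarrow> f (c *\<^sub>R x) \<le> c * f x"
    and bound: "f x \<le> L * norm x"
    and L_nonneg: "0 \<le> L"
begin

lemma lipschitz: "f x \<le> f y + L * norm (x - y)"
  using add[of y "x - y"] bound[of "x - y"] by simp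

lemma convex_combination:
  assumes "0 \<le> c" "c \<le> 1"
  shows "f ((1 - c) *\<^sub>R x + c *\<^sub>R y) \<le> (1 - c) * f x + c * f y"
  using add[of "(1 - c) *\<^sub>R x" "c *\<^sub>R y"] scale[of "1 - c" x] scale[of c y] assms by simp

definition quotient :: "'a \<Rightarrow> 'a \<Rightarrow> real \<Rightarrow> real" where
  "quotient x h t = (f (x + t *\<^sub>R h) - f x) / t"

lemma quotient_mono:
  assumes "0 < s" "s \<le> t"
  shows "quotient x h s \<le> quotient x h t"
proof -
  have "(1 - s / t) *\<^sub>R x + (s / t) *\<^sub>R (x + t *\<^sub>R h) = x + s *\<^sub>R h"
    using assms by (simp add: algebra_simps)
  then have "f (x + s *\<^sub>R h) - f x \<le> (s / t) * (f (x + t *\<^sub>R h) - f x)"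
    using convex_combination[of "s / t" x "x + t *\<^sub>R h"] assms by (simp add: algebra_simps)
  then show ?thesis
    using assms by (simp add: quotient_def field_simps)
qed

lemma quotient_lower: "0 < t \<Longrightarrow> - (L * norm h) \<le> quotient x h t"
  using lipschitz[of x "x + t *\<^sub>R h"] by (simp add: quotient_def field_simps)

lemma quotient_tendsto_dir_deriv: "(quotient x h \<longlongrightarrow> dir_deriv f x h) (at_right 0)"
proof -
  let ?S = "quotient x h ` {0<..}"
  have bdd: "bdd_below ?S"
    using quotient_lower by (intro bdd_belowI[of _ "- (L * norm h)"]) auto
  have "(quotient x h \<longlongrightarrow> Inf ?S) (at_right 0)"
  proof (rule order_tendstoI)
    fix a assume "a < Inf ?S"
    then have "a < quotient x h t" if "0 < t" for t
      using cInf_lower[OF _ bdd, of "quotient x h t"] that by auto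
    then show "\<forall>\<^sub>F t in at_right 0. a < quotient x h t"
      by (auto simp: eventually_at_right_less eventually_at_filter)
  next
    fix a assume "Inf ?S < a"
    then obtain t where t: "0 < t" "quotient x h t < a"
      using cInf_lessD[of ?S a] by auto
    then show "\<forall>\<^sub>F s in at_right 0. quotient x h s < a"
      unfolding eventually_at_right_field
      using quotient_mono by (intro exI[of _ t]) (meson less_imp_le le_less_trans)
  qed
  moreover from this have "dir_deriv f x h = Inf ?S"
    unfolding dir_deriv_def quotient_def[symmetric]
    by (intro tendsto_Lim) auto
  ultimately show ?thesis by simp
qed

lemma dir_deriv_add_uminus_nonneg: "0 \<le> dir_deriv f x h + dir_deriv f x (- h)"
proof (rule tendsto_lowerbound)
  show "((\<lambda>t. quotient x h t + quotient x (- h) t) \<longlongrightarrow> dir_deriv f x h + dir_deriv f x (- h))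
      (at_right 0)"
    by (intro tendsto_add quotient_tendsto_dir_deriv)
  have "0 \<le> quotient x h t + quotient x (- h) t" if "t > 0" for t
  proof -
    have "(1 - 1 / 2) *\<^sub>R (x + t *\<^sub>R h) + (1 / 2 :: real) *\<^sub>R (x - t *\<^sub>R h) = x"
      by (simp add: scaleR_add_right scaleR_diff_right scaleR_left_distrib[symmetric])
    with convex_combination[of "1 / 2" "x + t *\<^sub>R h" "x - t *\<^sub>R h"]
    have "0 \<le> (f (x + t *\<^sub>R h) - f x) + (f (x - t *\<^sub>R h) - f x)" by simp
    then show ?thesis using that by (simp add: quotient_def add_divide_distrib[symmetric])
  qed
  then show "\<forall>\<^sub>F t in at_right 0. 0 \<le> quotient x h t + quotient x (- h) t"
    by (auto simp: eventually_at_filter)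
qed simp

text \<open>
  A point at distance \<open>d\<close> from the epigraph violates the inequality that defines it by at most
  \<open>(1 + L) d\<close>.
\<close>
lemma le_infdist_epigraph: "f y \<le> r + (1 + L) * infdist (y, r) (epigraph UNIV f)"
proof -
  let ?K = "epigraph UNIV f"
  have ne: "?K \<noteq> {}" using mem_epigraph[of 0 "f 0" UNIV f] by auto
  have "(f y - r) / (1 + L) \<le> dist (y, r) p" if "p \<in> ?K" for p
  proof (cases p)
    case (Pair z t)
    have z: "f z \<le> t" using that Pair by (simp add: mem_epigraph)
    have n: "norm (y - z) \<le> dist (y, r) p" "norm (r - t) \<le> dist (y, r) p"
      using norm_fst_le[of "y - z" "r - t"] norm_snd_le[of "r - t" "y - z"] Pair
      by (simp_all add: dist_norm)
    have "L * norm (y - z) \<le> L * dist (y, r) p"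
      using n(1) L_nonneg by (rule mult_left_mono)
    then have "f y - r \<le> (1 + L) * dist (y, r) p"
      using lipschitz[of y z] z n(2) by (simp add: algebra_simps)
    then show ?thesis using L_nonneg by (simp add: divide_le_eq mult.commute)
  qed
  then have "(f y - r) / (1 + L) \<le> infdist (y, r) ?K"
    unfolding infdist_notempty[OF ne] by (intro cINF_greatest[OF ne])
  then show ?thesis using L_nonneg by (simp add: divide_le_eq algebra_simps)
qed

text \<open>
  Along \<open>(h, \<tau>)\<close> the point at step \<open>t\<close> lies below the graph by \<open>t\<close> times the excess of the difference
  quotient over \<open>\<tau>\<close>. Up to constant factors this excess is the distance to the epigraph, so the
  distance is \<open>o(t)\<close> just when the limit of the quotients is at most \<open>\<tau>\<close>.
\<close>
lemma tangent_cone_epigraph: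
  "(h, \<tau>) \<in> tangent_cone (epigraph UNIV f) (x, f x) \<longleftrightarrow> dir_deriv f x h \<le> \<tau>"
proof
  let ?d = "\<lambda>t :: real. infdist ((x, f x) + t *\<^sub>R (h, \<tau>)) (epigraph UNIV f)"
  assume "(h, \<tau>) \<in> tangent_cone (epigraph UNIV f) (x, f x)"
  then obtain \<rho> :: "nat \<Rightarrow> real" where \<rho>: "\<And>j. \<rho> j > 0" "\<rho> \<longlonglongrightarrow> 0"
    "(\<lambda>j. ?d (\<rho> j)) \<in> o(\<rho>)"
    by (auto simp: tangent_cone_def)
  have "filterlim \<rho> (at_right 0) sequentially"
    using \<rho>(1,2) by (intro tendsto_imp_filterlim_at_right) auto
  then have lim: "(\<lambda>j. quotient x h (\<rho> j)) \<longlonglongrightarrow> dir_deriv f x h"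
    by (rule filterlim_compose[OF quotient_tendsto_dir_deriv])
  have "(\<lambda>j. \<tau> + (1 + L) * (?d (\<rho> j) / \<rho> j)) \<longlonglongrightarrow> \<tau> + (1 + L) * 0"
    using smalloD_tendsto[OF \<rho>(3)] by (intro tendsto_intros)
  moreover have "quotient x h (\<rho> j) \<le> \<tau> + (1 + L) * (?d (\<rho> j) / \<rho> j)" for j
  proof -
    have "f (x + \<rho> j *\<^sub>R h) - f x \<le> \<rho> j * \<tau> + (1 + L) * ?d (\<rho> j)"
      using le_infdist_epigraph[of "x + \<rho> j *\<^sub>R h" "f x + \<rho> j * \<tau>"] by simp
    from divide_right_mono[OF this, of "\<rho> j"] show ?thesis
      using \<rho>(1)[of j] by (simp add: quotient_def add_divide_distrib)
  qed
  ultimately show "dir_deriv f x h \<le> \<tau>"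
    using LIMSEQ_le[OF lim] by auto
next
  let ?d = "\<lambda>t :: real. infdist ((x, f x) + t *\<^sub>R (h, \<tau>)) (epigraph UNIV f)"
  assume le: "dir_deriv f x h \<le> \<tau>"
  define \<rho> :: "nat \<Rightarrow> real" where "\<rho> j = inverse (real (Suc j))" for j
  have \<rho>: "\<And>j. \<rho> j > 0" "\<rho> \<longlonglongrightarrow> 0"
    using LIMSEQ_inverse_real_of_nat by (auto simp: \<rho>_def[abs_def])
  have "filterlim \<rho> (at_right 0) sequentially"
    using \<rho> by (intro tendsto_imp_filterlim_at_right) auto
  then have "(\<lambda>j. quotient x h (\<rho> j)) \<longlonglongrightarrow> dir_deriv f x h"
    by (rule filterlim_compose[OF quotient_tendsto_dir_deriv])
  then have "(\<lambda>j. max 0 (quotient x h (\<rho> j) - \<tau>)) \<longlonglongrightarrow> max 0 (dir_deriv f x h - \<tau>)"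
    by (intro tendsto_intros)
  moreover have "max 0 (dir_deriv f x h - \<tau>) = 0" using le by simp
  ultimately have lim: "(\<lambda>j. max 0 (quotient x h (\<rho> j) - \<tau>)) \<longlonglongrightarrow> 0" by simp
  \<comment> \<open>The vertical distance to the graph bounds the distance to the epigraph.\<close>
  have ub: "?d (\<rho> j) / \<rho> j \<le> max 0 (quotient x h (\<rho> j) - \<tau>)" for j
  proof -
    let ?y = "x + \<rho> j *\<^sub>R h" and ?r = "f x + \<rho> j * \<tau>"
    have "(?y, max ?r (f ?y)) \<in> epigraph UNIV f" by (simp add: mem_epigraph)
    then have "?d (\<rho> j) \<le> dist (?y, ?r) (?y, max ?r (f ?y))"
      using infdist_le by fastforce
    also have "\<dots> = max 0 (f ?y - ?r)" by (simp add: dist_Pair_Pair dist_real_def max_def)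
    also have "\<dots> = \<rho> j * max 0 (quotient x h (\<rho> j) - \<tau>)"
      using \<rho>(1)[of j] by (simp add: quotient_def max_def field_simps)
    finally show ?thesis using \<rho>(1)[of j] by (simp add: divide_le_eq mult.commute)
  qed
  have "(\<lambda>j. ?d (\<rho> j) / \<rho> j) \<longlonglongrightarrow> 0"
    using \<rho>(1) by (intro tendsto_sandwich[OF _ _ tendsto_const lim] always_eventually allI ub)
      (simp add: infdist_nonneg less_imp_le)
  then have "(\<lambda>j. ?d (\<rho> j)) \<in> o(\<rho>)"
    using \<rho>(1) by (intro smalloI_tendsto) (auto simp: less_imp_neq[symmetric] intro!: always_eventually)
  then show "(h, \<tau>) \<in> tangent_cone (epigraph UNIV f) (x, f x)"
    using \<rho> unfolding tangent_cone_def by blast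
qed

text \<open>
  Since \<open>f'(x; h) + f'(x; -h) \<ge> 0\<close>, the interval of all \<open>\<tau>\<close> with \<open>f'(x; h) \<le> \<tau> \<le> - f'(x; -h)\<close> is empty
  or the single point \<open>f'(x; h)\<close>, and the latter happens for \<open>h\<close> in \<open>T_lin f x\<close>.
\<close>
lemma lineality_tangent_cone_epigraph:
  "lineality (tangent_cone (epigraph UNIV f) (x, f x)) = {(h, dir_deriv f x h) |h. h \<in> T_lin f x}"
proof -
  have "(h, \<tau>) \<in> lineality (tangent_cone (epigraph UNIV f) (x, f x)) \<longleftrightarrow>
      dir_deriv f x h \<le> \<tau> \<and> dir_deriv f x (- h) \<le> - \<tau>" for h \<tau>
  proof -
    have "p \<in> uminus ` C \<longleftrightarrow> - p \<in> C" for p :: "'a \<times> real" and C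
      by (metis image_eqI image_iff minus_minus)
    then show ?thesis by (simp add: lineality_def tangent_cone_epigraph)
  qed
  moreover have "dir_deriv f x h \<le> \<tau> \<and> dir_deriv f x (- h) \<le> - \<tau> \<longleftrightarrow>
      h \<in> T_lin f x \<and> \<tau> = dir_deriv f x h" for h \<tau>
    using dir_deriv_add_uminus_nonneg[of x h] by (auto simp: T_lin_def)
  ultimately show ?thesis by auto
qed

end

section \<open>Constraint nondegeneracy\<close>

theorem proposition4p3:
  fixes g :: "'x::real_inner \<Rightarrow> real ^ 'n ^ 'm"
    and k :: nat
    and xbar :: 'x
    and Xbar :: "real ^ 'n ^ 'm"
    and tbar :: real
    and \<theta> :: "real ^ 'n ^ 'm \<Rightarrow> real"
    and K :: "((real ^ 'n ^ 'm) \<times> real) set"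
    and G :: "'x \<times> real \<Rightarrow> (real ^ 'n ^ 'm) \<times> real"
  assumes finite_dim: "\<exists>B :: 'x set. finite B \<and> span B = UNIV"
    and g_C1: "continuously_differentiable g"
    and k: "1 \<le> k" "k \<le> CARD('m)"
    and mn: "CARD('m) \<le> CARD('n)"
    and theta: "\<theta> = ky_fan_norm k"
    and K: "K = epigraph UNIV \<theta>"
    and G: "G = (\<lambda>(x, t). (g x, t))"
    and Xbar: "Xbar = g xbar"
    and tbar: "tbar = \<theta> Xbar"
  shows "range (frechet_derivative G (at (xbar, tbar))) + lineality (tangent_cone K (Xbar, tbar)) = UNIV
     \<longleftrightarrow> range (frechet_derivative g (at xbar)) + T_lin \<theta> Xbar = UNIV"
proof -
  obtain L where L: "L \<ge> 0" "\<And>Z :: real ^ 'n ^ 'm. ky_fan_norm k Z \<le> L * norm Z"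
    using ky_fan_norm_bounded[OF k(2)] by blast
  interpret bounded_sublinear \<theta> L
    unfolding theta
    by unfold_locales (use k(2) L in \<open>auto intro: ky_fan_norm_add ky_fan_norm_scaleR_le\<close>)
  obtain g' where g': "(g has_derivative g') (at xbar)"
    using g_C1 unfolding continuously_differentiable_def by blast
  have "((\<lambda>p. (g (fst p), snd p)) has_derivative (\<lambda>p. (g' (fst p), snd p))) (at (xbar, tbar))"
    using g' by (intro has_derivative_Pair has_derivative_compose[of fst fst _ _ g]
        has_derivative_fst has_derivative_snd has_derivative_ident) auto
  then have "(G has_derivative (\<lambda>p. (g' (fst p), snd p))) (at (xbar, tbar))"
    by (simp add: G case_prod_beta')
  then have G': "frechet_derivative G (at (xbar, tbar)) = (\<lambda>p. (g' (fst p), snd p))"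
    by (simp add: frechet_derivative_at[symmetric])
  have fg: "frechet_derivative g (at xbar) = g'"
    using g' by (simp add: frechet_derivative_at[symmetric])
  have lin: "lineality (tangent_cone K (Xbar, tbar)) =
      {(h, dir_deriv \<theta> Xbar h) |h. h \<in> T_lin \<theta> Xbar}"
    unfolding K tbar by (rule lineality_tangent_cone_epigraph)
  have "(y, r) \<in> range (frechet_derivative G (at (xbar, tbar))) + lineality (tangent_cone K (Xbar, tbar))
      \<longleftrightarrow> y \<in> range g' + T_lin \<theta> Xbar" for y r
  proof
    assume "(y, r) \<in> range (frechet_derivative G (at (xbar, tbar))) +
      lineality (tangent_cone K (Xbar, tbar))"
    then show "y \<in> range g' + T_lin \<theta> Xbar"
      unfolding G' lin
      by (auto elim!: set_plus_elim intro!: set_plus_intro)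
  next
    assume "y \<in> range g' + T_lin \<theta> Xbar"
    then obtain x h where h: "y = g' x + h" "h \<in> T_lin \<theta> Xbar"
      by (auto elim!: set_plus_elim)
    \<comment> \<open>The free last coordinate of \<open>G'\<close> absorbs the height of the graph over \<open>h\<close>.\<close>
    have "(g' x, r - dir_deriv \<theta> Xbar h) \<in> range (\<lambda>p. (g' (fst p), snd p))"
      by (auto intro!: image_eqI[of _ _ "(x, r - dir_deriv \<theta> Xbar h)"])
    from set_plus_intro[OF this, of "(h, dir_deriv \<theta> Xbar h)"
        "lineality (tangent_cone K (Xbar, tbar))"]
    show "(y, r) \<in> range (frechet_derivative G (at (xbar, tbar))) +
      lineality (tangent_cone K (Xbar, tbar))"
      using h unfolding G' lin by auto
  qed
  then show ?thesis unfolding fg by (auto simp: set_eq_iff)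
qed

end
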